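(* Let $R>\sqrt3+\frac1{\sqrt3}$, $\Omega=(-R,R)$, and let $u:\Omega\to\mathbb{R}$ be the function $$u(x)=\begin{cases}0,&|x|\le R-\sqrt3,\\ \dfrac{(|x|-R+\sqrt3)^2(R+2\sqrt3-|x|)}{6\sqrt3},&|x|>R-\sqrt3.\end{cases}$$ Then the distribution $\varphi\mapsto\int_\Omega u''(x)\varphi''(x)\,\mathrm{d}x$ on $\Omega$ cannot be represented by a signed Radon measure; that is, there is no signed Radon measure $\mu$ on $\Omega$ such that $\int_\Omega u''\varphi''\,\mathrm{d}x=\int_\Omega\varphi\,\mathrm{d}\mu$ for all $\varphi\in C_0^\infty(\Omega)$.
   Context: A signed Radon measure on $\Omega$ is a difference $\mu=\mu_+-\mu_-$ of two (nonnegative, locally finite) Radon measures on $\Omega$, with $\int\varphi\,\mathrm{d}\mu=\int\varphi\,\mathrm{d}\mu_+-\int\varphi\,\mathrm{d}\mu_-$ for $\varphi\in C_0^\infty(\Omega)$. Background (known from earlier work, not part of the claim): this $u$ is the unique minimizer of $\mathcal{F}(v,\Omega)=\int_\Omega(v'')^2\,\mathrm{d}x+|\{x\in\Omega:v(x)\ne0\}|$ among all $v\in H^2(\Omega)$ with $v-1\in H_0^1(\Omega)$. *)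

theory Defs
  imports "HOL-Analysis.Analysis"
begin

text \<open>Only the values on the open interval \<open>{-R<..<R}\<close> are relevant; the same formula is
  used outside. The function is continuously differentiable on that interval and twice
  differentiable there except at the two points \<open>\<bar>x\<bar> = R - sqrt 3\<close>, with bounded second derivative,
  so its weak second derivative is represented by \<open>deriv (deriv (u_fun R))\<close>: the value of
  \<open>deriv\<close> at the two exceptional points is unspecified but they form a null set.\<close>

definition u_fun :: "real \<Rightarrow> real \<Rightarrow> real" where
  "u_fun R x =
     (if \<bar>x\<bar> \<le> R - sqrt 3 then 0
      else (\<bar>x\<bar> - R + sqrt 3)\<^sup>2 * (R + 2 * sqrt 3 - \<bar>x\<bar>) / (6 * sqrt 3))"

text \<open>An element of \<open>C\<^sub>0\<^sup>\<infinity>(\<Omega>)\<close> is represented by its extension by zero to the real line.\<close>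

definition test_functions :: "real set \<Rightarrow> (real \<Rightarrow> real) set" where
  "test_functions \<Omega> =
     {\<phi>. (\<forall>k x. (deriv ^^ k) \<phi> differentiable (at x)) \<and>
         compact (closure {x. \<phi> x \<noteq> 0}) \<and> closure {x. \<phi> x \<noteq> 0} \<subseteq> \<Omega>}"

text \<open>Radon measures on the subspace \<open>S\<close>: Borel, locally finite, inner regular.
  (On an open interval inner regularity follows from the other two conditions.)\<close>

definition radon_measure_on :: "'a::t2_space set \<Rightarrow> 'a measure \<Rightarrow> bool" where
  "radon_measure_on S M \<longleftrightarrow>
     sets M = sets (restrict_space borel S) \<and>
     (\<forall>x\<in>S. \<exists>V. open V \<and> x \<in> V \<and> emeasure M (V \<inter> S) < \<infinity>) \<and>
     (\<forall>A\<in>sets M. emeasure M A = (SUP K\<in>{K. compact K \<and> K \<subseteq> A}. emeasure M K))"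

text \<open>Both parts of a signed Radon measure may have infinite total mass, so the difference need
  not be defined on every Borel set; it is encoded as the pair of its two parts and acts on test
  functions through the difference of the two integrals.\<close>

definition signed_radon_measure_on :: "'a::t2_space set \<Rightarrow> 'a measure \<times> 'a measure \<Rightarrow> bool" where
  "signed_radon_measure_on S \<mu> \<longleftrightarrow> radon_measure_on S (fst \<mu>) \<and> radon_measure_on S (snd \<mu>)"

definition signed_integral :: "'a measure \<times> 'a measure \<Rightarrow> ('a \<Rightarrow> real) \<Rightarrow> real" where
  "signed_integral \<mu> \<phi> = (LINT x|fst \<mu>. \<phi> x) - (LINT x|snd \<mu>. \<phi> x)"

end

theory Submission
  imports Defs "HOL-Computational_Algebra.Polynomial"
begin

text \<open>Near the point \<open>a = R - sqrt 3\<close> the second derivative of \<open>u\<close> jumps from \<open>0\<close> to \<open>1\<close>, and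
  to the right of \<open>a\<close> it is the affine function \<open>1 - (x - a) / sqrt 3\<close>. Two integrations by
  parts therefore turn the distribution, on test functions supported in \<open>{0<..<R}\<close>, into
  \<open>\<phi> \<mapsto> - \<phi>' a - \<phi> a / sqrt 3\<close> (\<open>distribution_near_right_free_boundary\<close>). A jump of \<open>u''\<close> thus
  contributes a dipole at \<open>a\<close>, which is a distribution of order one and hence no measure: a
  signed Radon measure is bounded on test functions with values in \<open>{0..1}\<close> and support in a fixed
  compact set (\<open>radon_measure_on_integral_bound\<close>), whereas \<open>\<phi>' a\<close> is unbounded there.

  The latter is seen by squeezing one bump function towards \<open>a\<close>: with
  \<open>\<psi> y = exp (- 1 / (1 - y\<^sup>2))\<close> for \<open>\<bar>y\<bar> < 1\<close> and \<open>0\<close> elsewhere, take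
  \<open>\<phi> x = \<psi> (1 / 2 + s * (x - a))\<close> and let \<open>s\<close> grow. The value \<open>\<phi> a = \<psi> (1 / 2)\<close> is fixed, while
  \<open>\<phi>' a = s * \<psi>' (1 / 2)\<close> is negative and tends to minus infinity.\<close>

section \<open>Smooth bump functions\<close>

text \<open>For \<open>k = 0\<close> this is the classical smooth function that is flat at the origin. The negative
  powers are included because its derivatives are combinations of such functions.\<close>

definition flat :: "nat \<Rightarrow> real \<Rightarrow> real" where
  "flat k y = (if 0 < y then exp (- 1 / y) / y ^ k else 0)"

lemma flat_nonneg: "0 \<le> flat k y"
  by (simp add: flat_def)

lemma flat_eq_mult_flat_Suc: "flat k y = y * flat (Suc k) y"
  by (simp add: flat_def)

lemma power_le_fact_times_exp:
  fixes z :: real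
  assumes "0 \<le> z"
  shows "z ^ k \<le> fact k * exp z"
proof -
  have "(\<Sum>n\<in>{k}. z ^ n /\<^sub>R fact n) \<le> (\<Sum>n. z ^ n /\<^sub>R fact n)"
    using assms by (intro sum_le_suminf summable_exp_generic) auto
  then show ?thesis
    by (simp add: exp_def field_simps)
qed

text \<open>This bound is uniform in \<open>y\<close>; together with \<open>flat k y = y\<^sup>2 * flat (k + 2) y\<close> it makes every
  \<open>flat k\<close> vanish to second order at the origin.\<close>

lemma flat_le_fact: "flat k y \<le> fact k"
  using power_le_fact_times_exp[of "1 / y" k]
  by (auto simp: flat_def exp_minus field_simps)

lemma has_real_derivative_flat:
  "(flat k has_real_derivative (flat (k + 2) y - of_nat k * flat (k + 1) y)) (at y)"
proof -
  consider "y < 0" | "y = 0" | "0 < y" by linarith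
  then show ?thesis
  proof cases
    case 1
    have "((\<lambda>_. 0) has_real_derivative 0) (at y)" by simp
    then have "(flat k has_real_derivative 0) (at y)"
      by (rule has_field_derivative_transform_within_open[where S = "{..<0}"])
         (use 1 in \<open>auto simp: flat_def\<close>)
    then show ?thesis using 1 by (simp add: flat_def)
  next
    case 2
    have "((\<lambda>h. flat k h / h) \<longlongrightarrow> 0) (at 0)"
    proof (rule Lim_null_comparison)
      show "\<forall>\<^sub>F h in at 0. norm (flat k h / h) \<le> fact (k + 2) * \<bar>h\<bar>"
      proof (rule always_eventually, rule allI)
        fix h :: real
        have "flat k h / h = h * flat (k + 2) h"
          using flat_eq_mult_flat_Suc[of k h] flat_eq_mult_flat_Suc[of "Suc k" h]
          by (cases "h = 0") auto
        then have "norm (flat k h / h) = \<bar>h\<bar> * flat (k + 2) h"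
          using flat_nonneg[of "k + 2" h] by (simp add: abs_mult)
        also have "\<dots> \<le> \<bar>h\<bar> * fact (k + 2)"
          by (intro mult_left_mono flat_le_fact) auto
        finally show "norm (flat k h / h) \<le> fact (k + 2) * \<bar>h\<bar>"
          by (simp add: mult.commute)
      qed
      show "((\<lambda>h. fact (k + 2) * \<bar>h\<bar>) \<longlongrightarrow> (0::real)) (at 0)"
        by (auto intro!: tendsto_eq_intros)
    qed
    then show ?thesis using 2 by (simp add: DERIV_def flat_def)
  next
    case 3
    have "((\<lambda>y. exp (- 1 / y) / y ^ k) has_real_derivative
            (flat (k + 2) y - of_nat k * flat (k + 1) y)) (at y)"
      using 3 by (auto intro!: derivative_eq_intros simp: flat_def field_simps power2_eq_square)
        (cases k; simp add: field_simps)
    then show ?thesis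
      by (rule has_field_derivative_transform_within_open[where S = "{0<..}"])
         (use 3 in \<open>auto simp: flat_def\<close>)
  qed
qed

text \<open>The functions \<open>p * flat k \<circ> q\<close> with polynomials \<open>p\<close>, \<open>q\<close> are closed under differentiation: the
  three terms of the derivative can be brought over the common denominator \<open>q ^ (k + 2)\<close>. This
  makes all higher derivatives accessible at once.\<close>

lemma has_real_derivative_poly_mult_flat_poly:
  "((\<lambda>x. poly p x * flat k (poly q x)) has_real_derivative
     poly (pderiv p * q\<^sup>2 + p * pderiv q * (1 - of_nat k * q)) x * flat (k + 2) (poly q x)) (at x)"
proof -
  have 1: "flat k (poly q x) = (poly q x)\<^sup>2 * flat (k + 2) (poly q x)"
          "flat (k + 1) (poly q x) = poly q x * flat (k + 2) (poly q x)"
    using flat_eq_mult_flat_Suc[of k "poly q x"] flat_eq_mult_flat_Suc[of "Suc k" "poly q x"]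
    by (auto simp: power2_eq_square)
  have "((\<lambda>x. flat k (poly q x)) has_real_derivative
     (flat (k + 2) (poly q x) - of_nat k * flat (k + 1) (poly q x)) * poly (pderiv q) x) (at x)"
    by (rule DERIV_chain2[OF has_real_derivative_flat poly_DERIV])
  from DERIV_mult[OF poly_DERIV[of p] this]
  show ?thesis
    by (rule DERIV_cong) (unfold 1, simp add: algebra_simps of_nat_poly)
qed

lemma deriv_funpow_flat_poly:
  "\<exists>p. (deriv ^^ j) (\<lambda>x. flat 0 (poly q x)) = (\<lambda>x. poly p x * flat (2 * j) (poly q x))"
proof (induction j)
  case 0
  show ?case by (rule exI[of _ 1]) simp
next
  case (Suc j)
  then obtain p where
    "(deriv ^^ j) (\<lambda>x. flat 0 (poly q x)) = (\<lambda>x. poly p x * flat (2 * j) (poly q x))" ..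
  then have "(deriv ^^ Suc j) (\<lambda>x. flat 0 (poly q x)) =
      deriv (\<lambda>x. poly p x * flat (2 * j) (poly q x))"
    by simp
  also have "\<dots> = (\<lambda>x. poly (pderiv p * q\<^sup>2 + p * pderiv q * (1 - of_nat (2 * j) * q)) x *
      flat (2 * Suc j) (poly q x))"
    using DERIV_imp_deriv[OF has_real_derivative_poly_mult_flat_poly[of p "2 * j" q]]
    by (intro ext) (simp only: mult_Suc_right add.commute)
  finally show ?case by blast
qed

lemma flat_poly_in_test_functions:
  assumes "compact K" "K \<subseteq> \<Omega>" and "\<And>x. 0 < poly q x \<Longrightarrow> x \<in> K"
  shows "(\<lambda>x. flat 0 (poly q x)) \<in> test_functions \<Omega>"
proof -
  have "(deriv ^^ k) (\<lambda>x. flat 0 (poly q x)) differentiable (at x)" for k x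
    using deriv_funpow_flat_poly[of k q] has_real_derivative_poly_mult_flat_poly
    by (metis real_differentiable_def)
  moreover have "closure {x. flat 0 (poly q x) \<noteq> 0} \<subseteq> K"
    using assms by (intro closure_minimal compact_imp_closed) (auto simp: flat_def split: if_splits)
  moreover from this have "compact (closure {x. flat 0 (poly q x) \<noteq> 0})"
    using assms(1) compact_Int_closed[of K "closure {x. flat 0 (poly q x) \<noteq> 0}"]
    by (simp add: Int_absorb1)
  ultimately show ?thesis
    using assms(2) by (auto simp: test_functions_def)
qed

section \<open>The distribution near the free boundary\<close>

lemma deriv_deriv_u_fun_contact:
  assumes "0 < x" "x < R - sqrt 3"
  shows "deriv (deriv (u_fun R)) x = 0"
proof -
  have u': "deriv (u_fun R) y = 0" if "y \<in> {0<..<R - sqrt 3}" for y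
  proof (rule DERIV_imp_deriv)
    have "((\<lambda>_. 0) has_real_derivative 0) (at y)" by simp
    then show "(u_fun R has_real_derivative 0) (at y)"
      by (rule has_field_derivative_transform_within_open[where S = "{0<..<R - sqrt 3}"])
         (use that in \<open>auto simp: u_fun_def\<close>)
  qed
  have "((\<lambda>_. 0) has_real_derivative 0) (at x)" by simp
  then have "(deriv (u_fun R) has_real_derivative 0) (at x)"
    by (rule has_field_derivative_transform_within_open[where S = "{0<..<R - sqrt 3}"])
       (use assms in \<open>simp_all add: u'\<close>)
  then show ?thesis by (rule DERIV_imp_deriv)
qed

lemma deriv_deriv_u_fun_positive:
  assumes "0 \<le> R - sqrt 3" "R - sqrt 3 < x"
  shows "deriv (deriv (u_fun R)) x = 1 - (x - (R - sqrt 3)) / sqrt 3"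
proof -
  define a where "a = R - sqrt 3"
  have sqrt3: "d / sqrt 3 = sqrt 3 * d / 3" for d :: real
    by (simp add: field_simps)
  have u: "u_fun R y = (y - a)\<^sup>2 / 2 - (y - a) ^ 3 / (6 * sqrt 3)" if "y \<in> {a<..}" for y
  proof -
    have "u_fun R y = (y - a)\<^sup>2 * (3 * sqrt 3 - (y - a)) / (6 * sqrt 3)"
      using that assms(1) by (simp add: u_fun_def a_def algebra_simps)
    also have "\<dots> = (y - a)\<^sup>2 * (3 * sqrt 3) / (6 * sqrt 3) - (y - a)\<^sup>2 * (y - a) / (6 * sqrt 3)"
      by (simp only: right_diff_distrib diff_divide_distrib)
    finally show ?thesis by (simp add: power2_eq_square power3_eq_cube)
  qed
  have u': "deriv (u_fun R) y = (y - a) - sqrt 3 * (y - a)\<^sup>2 / 6" if "y \<in> {a<..}" for y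
  proof (rule DERIV_imp_deriv)
    have "((\<lambda>y. (y - a)\<^sup>2 / 2 - (y - a) ^ 3 / (6 * sqrt 3)) has_real_derivative
       (y - a) - sqrt 3 * (y - a)\<^sup>2 / 6) (at y)"
      by (rule derivative_eq_intros refl | simp)+
    then show "(u_fun R has_real_derivative (y - a) - sqrt 3 * (y - a)\<^sup>2 / 6) (at y)"
      by (rule has_field_derivative_transform_within_open[where S = "{a<..}"])
         (use that u in auto)
  qed
  have "((\<lambda>y. (y - a) - sqrt 3 * (y - a)\<^sup>2 / 6) has_real_derivative
      1 - (x - a) / sqrt 3) (at x)"
    unfolding sqrt3[of "x - a"] by (auto intro!: derivative_eq_intros)
  then have "(deriv (u_fun R) has_real_derivative 1 - (x - a) / sqrt 3) (at x)"
  proof (rule has_field_derivative_transform_within_open[where S = "{a<..}"])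
    show "x \<in> {a<..}" using assms(2) by (simp add: a_def)
  qed (simp_all only: u' open_greaterThan)
  then show ?thesis unfolding a_def by (rule DERIV_imp_deriv)
qed

lemma deriv_eq_0_outside:
  fixes f :: "real \<Rightarrow> real"
  assumes "closed K" "\<And>x. x \<notin> K \<Longrightarrow> f x = 0" "x \<notin> K"
  shows "deriv f x = 0"
proof (rule DERIV_imp_deriv)
  have "((\<lambda>_. 0) has_real_derivative 0) (at x)" by simp
  then show "(f has_real_derivative 0) (at x)"
    by (rule has_field_derivative_transform_within_open[where S = "- K"]) (use assms in auto)
qed

text \<open>Integration by parts on the single interval where \<open>u''\<close> and the support of \<open>\<phi>\<close> overlap: since
  the affine function \<open>u''\<close> has slope \<open>- 1 / sqrt 3\<close> there, \<open>u'' * \<phi>''\<close> has the primitive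
  \<open>u'' * \<phi>' + \<phi> / sqrt 3\<close>, and only its value at the free boundary point survives.\<close>

lemma distribution_near_right_free_boundary:
  assumes "sqrt 3 < R" and \<phi>: "\<phi> \<in> test_functions {0<..<R}"
  shows "(LINT x:{-R<..<R}|lborel. deriv (deriv (u_fun R)) x * deriv (deriv \<phi>) x) =
    - deriv \<phi> (R - sqrt 3) - \<phi> (R - sqrt 3) / sqrt 3"
proof -
  define a where "a = R - sqrt 3"
  have a: "0 < a" "a < R" using assms by (auto simp: a_def)
  define K where "K = closure {x. \<phi> x \<noteq> 0}"
  have K: "closed K" "K \<subseteq> {0<..<R}"
    using \<phi> by (auto simp: K_def test_functions_def)
  have z0: "\<phi> x = 0" if "x \<notin> K" for x
    using that closure_subset[of "{x. \<phi> x \<noteq> 0}"] by (auto simp: K_def)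
  have z1: "deriv \<phi> x = 0" if "x \<notin> K" for x
    by (rule deriv_eq_0_outside[OF K(1)]) (use z0 that in auto)
  have z2: "deriv (deriv \<phi>) x = 0" if "x \<notin> K" for x
    by (rule deriv_eq_0_outside[OF K(1)]) (use z1 that in auto)
  have diff: "(deriv ^^ k) \<phi> differentiable (at x)" for k x
    using \<phi> by (auto simp: test_functions_def)
  have d: "(\<phi> has_real_derivative deriv \<phi> x) (at x)"
          "(deriv \<phi> has_real_derivative deriv (deriv \<phi>) x) (at x)"
          "isCont (deriv (deriv \<phi>)) x" for x
    using diff[of 0 x] diff[of 1 x] diff[of 2 x]
    by (auto simp: DERIV_deriv_iff_real_differentiable numeral_2_eq_2 intro: differentiable_imp_continuous_within)
  define F where "F = (\<lambda>x. (1 - (x - a) / sqrt 3) * deriv \<phi> x + \<phi> x / sqrt 3)"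
  have "(LINT x:{-R<..<R}|lborel. deriv (deriv (u_fun R)) x * deriv (deriv \<phi>) x) =
      (LINT x|lborel. (1 - (x - a) / sqrt 3) * deriv (deriv \<phi>) x * indicator {a..R} x)"
    unfolding set_lebesgue_integral_def
    \<comment> \<open>\<open>u''\<close> does not exist at \<open>a\<close>; that null set is discarded\<close>
  proof (rule integral_discrete_difference[where X = "{a}"])
    fix x :: real assume x: "x \<notin> {a}"
    consider "x \<notin> K" | "0 < x" "x < a" | "a < x" "x < R"
      using K x by force
    then show "indicator {-R<..<R} x *\<^sub>R (deriv (deriv (u_fun R)) x * deriv (deriv \<phi>) x) =
      (1 - (x - a) / sqrt 3) * deriv (deriv \<phi>) x * indicator {a..R} x"
      by cases (use a assms in \<open>auto simp: z2 a_def deriv_deriv_u_fun_contact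
         deriv_deriv_u_fun_positive indicator_def\<close>)
  qed auto
  also have "\<dots> = F R - F a"
  proof (rule integral_FTC_Icc_real)
    show "a \<le> R" using a by simp
    show "(F has_real_derivative (1 - (x - a) / sqrt 3) * deriv (deriv \<phi>) x) (at x)" for x
      unfolding F_def using d by (auto intro!: derivative_eq_intros simp: field_simps)
    show "isCont (\<lambda>x. (1 - (x - a) / sqrt 3) * deriv (deriv \<phi>) x) x" for x
      using d(3) by (intro continuous_intros) auto
  qed
  also have "R \<notin> K" using K by auto
  then have "F R - F a = - deriv \<phi> a - \<phi> a / sqrt 3"
    by (simp add: F_def z0 z1)
  finally show ?thesis by (simp add: a_def)
qed

section \<open>Radon measures have order zero\<close>

lemma radon_measure_on_compact_finite:
  assumes "radon_measure_on S M" "compact K" "K \<subseteq> S"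
  shows "emeasure M K < \<infinity>"
proof -
  have sets: "sets M = sets (restrict_space borel S)"
    using assms(1) by (simp add: radon_measure_on_def)
  have "\<forall>x\<in>S. \<exists>V. open V \<and> x \<in> V \<and> emeasure M (V \<inter> S) < \<infinity>"
    using assms(1) unfolding radon_measure_on_def by (elim conjE)
  from bchoice[OF this] obtain V where
    "\<forall>x\<in>S. open (V x) \<and> x \<in> V x \<and> emeasure M (V x \<inter> S) < \<infinity>" ..
  then have V: "open (V x)" "x \<in> V x" "emeasure M (V x \<inter> S) < \<infinity>" if "x \<in> K" for x
    using that assms(3) by (simp_all add: subset_iff)
  obtain C where C: "C \<subseteq> K" "finite C" "K \<subseteq> (\<Union>x\<in>C. V x)"
  proof (rule compactE_image[OF assms(2), of K V])
    show "open (V x)" if "x \<in> K" for x using that by (rule V)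
    show "K \<subseteq> (\<Union>x\<in>K. V x)" using V(2) by blast
  qed
  have VS: "V x \<inter> S \<in> sets M" if "x \<in> C" for x
  proof -
    have "V x \<in> sets borel" using that C(1) by (intro borel_open V(1)) blast
    then show ?thesis unfolding sets sets_restrict_space by blast
  qed
  have "emeasure M K \<le> emeasure M (\<Union>x\<in>C. V x \<inter> S)"
  proof (rule emeasure_mono)
    show "K \<subseteq> (\<Union>x\<in>C. V x \<inter> S)" using C(3) assms(3) by blast
    show "(\<Union>x\<in>C. V x \<inter> S) \<in> sets M" using C(2) VS by (rule sets.finite_UN)
  qed
  also have "\<dots> \<le> (\<Sum>x\<in>C. emeasure M (V x \<inter> S))"
    by (rule emeasure_subadditive_finite[OF C(2)]) (use VS in blast)
  also have "\<dots> < \<infinity>"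
    using C(1,2) V(3) by (auto simp: subset_iff)
  finally show ?thesis .
qed

text \<open>The point is that the upper bound depends on \<open>K\<close> alone and not on any derivative of \<open>f\<close>:
  a Radon measure is a distribution of order zero.\<close>

lemma radon_measure_on_integral_bound:
  assumes "radon_measure_on S M" "compact K" "K \<subseteq> S"
    and "\<And>x. 0 \<le> f x" "\<And>x. f x \<le> 1" "\<And>x. x \<notin> K \<Longrightarrow> f x = 0"
  shows "(LINT x|M. f x) \<in> {0..measure M K}"
proof -
  have sets: "sets M = sets (restrict_space borel S)"
    using assms(1) by (simp add: radon_measure_on_def)
  have K: "K \<in> sets M"
    unfolding sets sets_restrict_space using assms(2,3) borel_compact[OF assms(2)]
    by (auto simp: image_iff intro!: bexI[of _ K])
  have "integrable M (indicator K :: _ \<Rightarrow> real)"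
    using K radon_measure_on_compact_finite[OF assms(1-3)] by (rule integrable_real_indicator)
  then have "(LINT x|M. f x) \<le> (LINT x|M. indicator K x)"
    by (rule integral_mono') (use assms(4-6) in \<open>auto simp: indicator_def\<close>)
  also have "\<dots> = measure M K"
    using K sets.sets_into_space[OF K] by (simp add: Int_absorb2)
  finally show ?thesis using assms(4) by simp
qed

section \<open>The dipole is not a measure\<close>

theorem mainTheorem7:
  fixes R :: real
  assumes "R > sqrt 3 + 1 / sqrt 3"
  shows "\<not> (\<exists>\<mu> :: real measure \<times> real measure.
           signed_radon_measure_on {-R<..<R} \<mu> \<and>
           (\<forall>\<phi>\<in>test_functions {-R<..<R}.
              (LINT x:{-R<..<R}|lborel. deriv (deriv (u_fun R)) x * deriv (deriv \<phi>) x)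
                = signed_integral \<mu> \<phi>))"
proof
  assume "\<exists>\<mu> :: real measure \<times> real measure.
           signed_radon_measure_on {-R<..<R} \<mu> \<and>
           (\<forall>\<phi>\<in>test_functions {-R<..<R}.
              (LINT x:{-R<..<R}|lborel. deriv (deriv (u_fun R)) x * deriv (deriv \<phi>) x)
                = signed_integral \<mu> \<phi>)"
  then obtain \<mu> :: "real measure \<times> real measure" where
    \<mu>: "radon_measure_on {-R<..<R} (fst \<mu>)" "radon_measure_on {-R<..<R} (snd \<mu>)" and
    rep: "\<And>\<phi>. \<phi> \<in> test_functions {-R<..<R} \<Longrightarrow>
       (LINT x:{-R<..<R}|lborel. deriv (deriv (u_fun R)) x * deriv (deriv \<phi>) x)
                = signed_integral \<mu> \<phi>"
    by (auto simp: signed_radon_measure_on_def)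
  have "0 < 1 / sqrt 3" by simp
  with assms have R: "sqrt 3 < R" by linarith
  define a where "a = R - sqrt 3"
  \<comment> \<open>the compact interval \<open>K\<close>, and with it the bound \<open>C\<close>, has to be fixed before the scale \<open>s\<close>\<close>
  define \<delta> where "\<delta> = min a (sqrt 3) / 2"
  define K where "K = {a - \<delta>..a + \<delta>}"
  have \<delta>: "0 < \<delta>" using R by (simp add: \<delta>_def a_def)
  have "0 < a - \<delta>" "a + \<delta> < R"
    using R by (simp_all add: \<delta>_def a_def min_def)
  then have K: "compact K" "K \<subseteq> {0<..<R}" "K \<subseteq> {-R<..<R}"
    by (auto simp: K_def)
  define C where "C = measure (fst \<mu>) K"
  define B where "B = flat 0 (3 / 4) / sqrt 3 + C"
  \<comment> \<open>the first bound on \<open>s\<close> keeps the squeezed bump inside \<open>K\<close>, the second makes the dipole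
     term exceed what the measure allows\<close>
  define s where "s = max (2 / \<delta>) ((B + 1) / flat 2 (3 / 4))"
  \<comment> \<open>centring the bump off \<open>a\<close> gives it a nonzero slope at \<open>a\<close>\<close>
  define q where "q = 1 - [:1 / 2 - s * a, s:]\<^sup>2"
  define \<phi> where "\<phi> = (\<lambda>x. flat 0 (poly q x))"
  have q: "poly q x = 1 - (1 / 2 + s * (x - a))\<^sup>2" for x
    by (simp add: q_def algebra_simps)
  have supp: "x \<in> K" if "0 < poly q x" for x
  proof -
    have "\<bar>1 / 2 + s * (x - a)\<bar> < 1"
      using that by (simp add: q abs_square_less_1)
    then have "\<bar>s * (x - a)\<bar> \<le> 2" by linarith
    moreover have "2 / \<delta> \<le> \<bar>s\<bar>"
      by (rule order_trans[OF _ abs_ge_self]) (simp add: s_def)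
    then have "2 / \<delta> * \<bar>x - a\<bar> \<le> \<bar>s * (x - a)\<bar>"
      unfolding abs_mult by (rule mult_right_mono) simp
    ultimately have "2 / \<delta> * \<bar>x - a\<bar> \<le> 2" by linarith
    then have "\<bar>x - a\<bar> \<le> \<delta>" using \<delta> by (simp add: divide_le_eq)
    then show ?thesis by (auto simp: K_def)
  qed
  have test: "\<phi> \<in> test_functions {0<..<R}" "\<phi> \<in> test_functions {-R<..<R}"
    unfolding \<phi>_def
    by (rule flat_poly_in_test_functions[OF K(1) K(2) supp]
          flat_poly_in_test_functions[OF K(1) K(3) supp]; assumption)+
  have qa: "poly q a = 3 / 4" "poly (pderiv q) a = - s"
    by (simp add: q power2_eq_square)
       (simp add: q_def pderiv_diff pderiv_mult pderiv_pCons power2_eq_square algebra_simps)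
  have "(\<phi> has_real_derivative - s * flat 2 (3 / 4)) (at a)"
    unfolding \<phi>_def
    using DERIV_chain2[OF has_real_derivative_flat[of 0 "poly q a"] poly_DERIV]
    by (simp add: qa numeral_2_eq_2 mult.commute)
  then have "(LINT x:{-R<..<R}|lborel. deriv (deriv (u_fun R)) x * deriv (deriv \<phi>) x)
      = s * flat 2 (3 / 4) - flat 0 (3 / 4) / sqrt 3"
    using distribution_near_right_free_boundary[OF R test(1)]
    by (simp add: DERIV_imp_deriv a_def[symmetric]) (simp add: \<phi>_def qa)
  \<comment> \<open>as \<open>\<phi>\<close> is nonnegative, the negative part of the measure can only lower the integral\<close>
  moreover have "signed_integral \<mu> \<phi> \<le> C"
  proof -
    have "0 \<le> \<phi> x" "\<phi> x \<le> 1" "x \<notin> K \<Longrightarrow> \<phi> x = 0" for x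
      using flat_nonneg flat_le_fact[of 0 "poly q x"] supp[of x] by (auto simp: \<phi>_def flat_def)
    then have "(LINT x|M. \<phi> x) \<in> {0..measure M K}" if "radon_measure_on {-R<..<R} M" for M
      using radon_measure_on_integral_bound[OF that K(1,3)] by blast
    from this[OF \<mu>(1)] this[OF \<mu>(2)] show ?thesis
      by (simp add: signed_integral_def C_def)
  qed
  ultimately have "s * flat 2 (3 / 4) \<le> B"
    using rep[OF test(2)] by (simp add: B_def)
  moreover have "0 < flat 2 (3 / 4)" by (simp add: flat_def)
  then have "B + 1 \<le> s * flat 2 (3 / 4)"
    by (subst pos_divide_le_eq[symmetric]) (simp_all add: s_def)
  ultimately show False by simp
qed

end
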